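(* Let $G \in ER(n,d,\lambda)$ and let $x \ge 1$ be an integer. Then $D_n^x(G,G)$ is edge-regular if and only if there exist integers $\bar d, \bar\lambda$ such that: (1) for all $v \in V(G)$, $d(1 + |N^x(v)|) = \bar d$; (2) for all $u,v \in V(G)$ with $u \sim v$ in $G$, $\lambda + d|N^x(u) \cap N^x(v)| = \bar\lambda$; (3) for all $v,w \in V(G)$ with $w \in N^x(v)$, $|N^x(v) \cap N(w)| + |N(v) \cap N^x(w)| + \lambda|N^x(v) \cap N^x(w)| = \bar\lambda$.
   Context: All graphs are finite and simple. For a vertex $v$ of $G$, $N(v)$ is its neighborhood and, for a positive integer $x$, $N^x(v)$ is the set of vertices at distance exactly $x$ from $v$ in $G$. A graph is edge-regular if it is regular and there is $\lambda \ge 0$ such that every two adjacent vertices have exactly $\lambda$ common neighbors; $ER(n,d,\lambda)$ denotes the set of edge-regular graphs on $n$ vertices, regular of degree $d$, with parameter $\lambda$. For finite graphs $G, H$ with $m = |V(H)|$, vertices of $H$ ordered $w_1,\dots,w_m$, and $x \ge 1$, the $(H,x)$-shadow $D_m^x(G,H)$ is the simple graph whose vertex set is the disjoint union of $m$ copies $G_1,\dots,G_m$ of $G$ (the copy of $u\in V(G)$ in $G_i$ denoted $u_i$), with edges $u_iv_i$ for $uv \in E(G)$, and edges $u_iv_j$ for $i \ne j$ whenever $w_iw_j \in E(H)$ and $u \in N_G^x(v)$. Here $H = G$, so $m = n$. *)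

theory Defs
  imports "Graph_Theory.Pair_Digraph" "Graph_Theory.Shortest_Path"
begin

text \<open>
  A finite simple graph is a \<^locale>\<open>pair_graph\<close>: a finite loop-free symmetric digraph without
  parallel arcs, so an edge \<open>uv\<close> is the pair of arcs \<open>(u, v)\<close>, \<open>(v, u)\<close>.
\<close>

definition nbhd :: "'a pair_pre_digraph \<Rightarrow> 'a \<Rightarrow> 'a set" where
  "nbhd G v = {u \<in> pverts G. (v, u) \<in> parcs G}"

text \<open>
  The graph distance is the shortest-path cost \<open>\<mu>\<close> for unit arc weights; it is \<open>\<infinity>\<close> if there is
  no walk, so vertices in other components belong to no \<open>nbhd_at G x v\<close>.
\<close>

definition nbhd_at :: "'a pair_pre_digraph \<Rightarrow> nat \<Rightarrow> 'a \<Rightarrow> 'a set" where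
  "nbhd_at G x v =
     {u \<in> pverts G. wf_digraph.\<mu> (with_proj G) (\<lambda>_. 1) v u = ereal (real x)}"

text \<open>
  In an edgeless graph every \<open>l\<close> satisfies the condition on adjacent vertices, so edgeless graphs
  are edge-regular, with \<open>l\<close> not uniquely determined.
\<close>

definition ER :: "nat \<Rightarrow> nat \<Rightarrow> nat \<Rightarrow> 'a pair_pre_digraph set" where
  "ER n d l = {G. pair_graph G \<and> card (pverts G) = n \<and>
     (\<forall>v \<in> pverts G. card (nbhd G v) = d) \<and>
     (\<forall>u v. (u, v) \<in> parcs G \<longrightarrow> card (nbhd G u \<inter> nbhd G v) = l)}"

definition edge_regular :: "'a pair_pre_digraph \<Rightarrow> bool" where
  "edge_regular G \<longleftrightarrow> (\<exists>n d l. G \<in> ER n d l)"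

text \<open>
  The shadow of \<open>G\<close> with respect to \<open>H\<close>, whose vertices are ordered as \<open>w 1, \<dots>, w m\<close>. The pair
  \<open>(u, i)\<close> is the copy of \<open>u\<close> in the \<open>i\<close>-th copy of \<open>G\<close>. The arc relation is symmetric because
  \<open>H\<close> and the distance in \<open>G\<close> are.
\<close>

definition shadow ::
  "'a pair_pre_digraph \<Rightarrow> 'b pair_pre_digraph \<Rightarrow> (nat \<Rightarrow> 'b) \<Rightarrow> nat \<Rightarrow> ('a \<times> nat) pair_pre_digraph"
where
  "shadow G H w x =
     (let m = card (pverts H) in
      \<lparr> pverts = pverts G \<times> {1..m},
        parcs =
          {((u, i), (v, i)) | u v i. i \<in> {1..m} \<and> (u, v) \<in> parcs G} \<union>
          {((u, i), (v, j)) | u v i j. i \<in> {1..m} \<and> j \<in> {1..m} \<and> i \<noteq> j \<and>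
             (w i, w j) \<in> parcs H \<and> v \<in> pverts G \<and> u \<in> nbhd_at G x v} \<rparr>)"

end

theory Submission
  imports Defs
begin

text \<open>
  The neighborhood of the vertex \<open>(u, i)\<close> of the shadow is the disjoint union of
  \<open>N(u) \<times> {i}\<close> and \<open>N\<^sup>x(u) \<times> {j. w\<^sub>i \<sim> w\<^sub>j}\<close>. Counting it gives the degree, and
  intersecting two such neighborhoods gives the number of common neighbors, separately for an
  edge inside one layer (condition 2) and an edge between two layers (condition 3). The
  conditions are necessary because every instance of them is realised by an edge of the shadow:
  if \<open>N\<^sup>x(v)\<close> is nonempty, then \<open>v\<close> has a neighbor in \<open>G\<close>, which yields two adjacent layers.
\<close>

section \<open>Symmetry of the distance and existence of a neighbor\<close>

lemma length_rev_path: "length (rev_path p) = length p"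
  by (induct p) auto

text \<open>Reversing a walk keeps its length, and under a constant weight the cost depends on the
  length only, so each of the two infima bounds the other.\<close>

lemma (in pair_sym_digraph) \<mu>_const_sym: "\<mu> (\<lambda>_. c) u v = \<mu> (\<lambda>_. c) v u"
proof -
  have le: "\<mu> (\<lambda>_. c) a b \<le> \<mu> (\<lambda>_. c) b a" for a b
    unfolding \<mu>_def
  proof (rule INF_mono)
    fix p assume "p \<in> {p. awalk b p a}"
    then have "rev_path p \<in> {p. awalk a p b}" by (simp add: awalk_rev_path')
    moreover have "awalk_cost (\<lambda>_. c) (rev_path p) = awalk_cost (\<lambda>_. c) p"
      by (simp add: awalk_cost_def sum_list_triv length_rev_path)
    ultimately show "\<exists>q\<in>{p. awalk a p b}. ereal (awalk_cost (\<lambda>_. c) q) \<le> ereal (awalk_cost (\<lambda>_. c) p)"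
      by (metis order_refl)
  qed
  show ?thesis by (rule antisym[OF le le])
qed

lemma nbhd_subset: "nbhd G u \<subseteq> pverts G"
  by (auto simp: nbhd_def)

lemma nbhd_at_subset: "nbhd_at G x u \<subseteq> pverts G"
  by (auto simp: nbhd_at_def)

lemma (in pair_wf_digraph) in_nbhd_iff: "v \<in> nbhd G u \<longleftrightarrow> (u, v) \<in> parcs G"
  by (auto simp: nbhd_def dest: in_arcsD2)

lemma (in pair_sym_digraph) nbhd_at_sym:
  assumes "u \<in> pverts G" "v \<in> nbhd_at G x u"
  shows "u \<in> nbhd_at G x v"
  using assms \<mu>_const_sym[of 1 u v] by (simp add: nbhd_at_def)

text \<open>A finite distance provides a walk from \<open>v\<close> to \<open>u\<close>. The empty
  walk costs 0, less than \<open>x\<close>, so the walk has a first arc, and this arc leaves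
  \<open>v\<close>.\<close>

lemma (in pair_wf_digraph) arc_of_nbhd_at:
  assumes "u \<in> nbhd_at G x v" "x \<ge> 1"
  obtains v' where "(v, v') \<in> parcs G"
proof -
  have eq: "\<mu> (\<lambda>_. 1) v u = ereal (real x)"
    using assms(1) by (simp add: nbhd_at_def)
  then have "v \<rightarrow>\<^sup>*\<^bsub>with_proj G\<^esub> u"
    using \<mu>_reach_conv[of "\<lambda>_. 1" v u] by simp
  then obtain p where p: "awalk v p u" by (auto simp: reachable_awalk)
  have "\<mu> (\<lambda>_. 1) v u \<le> awalk_cost (\<lambda>_. 1) p"
    by (rule min_cost_le_walk_cost[OF p])
  then have "p \<noteq> []" using eq assms(2) by auto
  then obtain e es where "p = e # es" by (cases p) auto
  then have "(v, snd e) \<in> parcs G" using p by (cases e) (auto simp: awalk_Cons_iff)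
  then show thesis by (rule that)
qed

section \<open>Layers and arcs of the shadow for arbitrary \<open>G\<close> and
  \<open>H\<close>\<close>

locale graph_shadow =
  G: pair_graph G + H: pair_graph H
  for G :: "'a pair_pre_digraph" and H :: "'b pair_pre_digraph" +
  fixes w :: "nat \<Rightarrow> 'b" and x :: nat
  assumes bij_w: "bij_betw w {1..card (pverts H)} (pverts H)"
begin

definition layer_nbhd :: "nat \<Rightarrow> nat set" where
  "layer_nbhd i = {j \<in> {1..card (pverts H)}. (w i, w j) \<in> parcs H}"

lemma layer_in_verts: "i \<in> {1..card (pverts H)} \<Longrightarrow> w i \<in> pverts H"
  using bij_w by (auto simp: bij_betw_def)

lemma finite_nbhd: "finite (nbhd G u)"
  by (rule finite_subset[OF nbhd_subset G.pair_finite_verts])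

lemma finite_nbhd_at: "finite (nbhd_at G x u)"
  by (rule finite_subset[OF nbhd_at_subset G.pair_finite_verts])

lemma finite_layer_nbhd: "finite (layer_nbhd i)"
  by (simp add: layer_nbhd_def)

lemma layer_nbhd_irrefl: "i \<notin> layer_nbhd i"
  using H.no_loops' by (auto simp: layer_nbhd_def)

lemma image_layer_nbhd: "w ` layer_nbhd i = nbhd H (w i)"
proof
  show "w ` layer_nbhd i \<subseteq> nbhd H (w i)"
    using layer_in_verts by (auto simp: layer_nbhd_def nbhd_def)
  show "nbhd H (w i) \<subseteq> w ` layer_nbhd i"
    using bij_w by (force simp: layer_nbhd_def nbhd_def bij_betw_def)
qed

text \<open>The union is what commuting \<open>w\<close> with an intersection requires;
  \<open>i = j\<close> gives the case of a single neighborhood.\<close>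

lemma inj_on_layer_nbhd: "inj_on w (layer_nbhd i \<union> layer_nbhd j)"
  by (rule inj_on_subset[of w "{1..card (pverts H)}"])
     (use bij_w in \<open>auto simp: bij_betw_def layer_nbhd_def\<close>)

lemma card_layer_nbhd: "card (layer_nbhd i) = card (nbhd H (w i))"
  using card_image[OF inj_on_layer_nbhd[of i i]] by (simp add: image_layer_nbhd)

lemma card_layer_nbhd_Int: "card (layer_nbhd i \<inter> layer_nbhd j) = card (nbhd H (w i) \<inter> nbhd H (w j))"
proof -
  have "nbhd H (w i) \<inter> nbhd H (w j) = w ` (layer_nbhd i \<inter> layer_nbhd j)"
    using inj_on_image_Int[OF inj_on_layer_nbhd, of "layer_nbhd i" i j "layer_nbhd j"]
    by (simp add: image_layer_nbhd)
  moreover have "inj_on w (layer_nbhd i \<inter> layer_nbhd j)"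
    by (rule inj_on_subset[OF inj_on_layer_nbhd[of i j]]) auto
  ultimately show ?thesis by (simp add: card_image)
qed

lemma pverts_shadow: "pverts (shadow G H w x) = pverts G \<times> {1..card (pverts H)}"
  by (simp add: shadow_def Let_def)

text \<open>Symmetry of the distance turns the definition's \<open>u \<in> nbhd_at G x v\<close>
  around, so that the arcs leaving \<open>(u, i)\<close> can be read off from \<open>u\<close> and
  \<open>i\<close>. The condition \<open>i \<noteq> j\<close> is absorbed because \<open>H\<close>
  has no loops.\<close>

lemma arc_shadow_iff:
  "((u, i), (v, j)) \<in> parcs (shadow G H w x) \<longleftrightarrow>
     u \<in> pverts G \<and> i \<in> {1..card (pverts H)} \<and>
     ((u, v) \<in> parcs G \<and> i = j \<or> v \<in> nbhd_at G x u \<and> j \<in> layer_nbhd i)"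
  (is "?L \<longleftrightarrow> ?R")
proof
  assume ?L
  then consider "i = j" "i \<in> {1..card (pverts H)}" "(u, v) \<in> parcs G"
    | "i \<in> {1..card (pverts H)}" "j \<in> layer_nbhd i" "v \<in> pverts G" "u \<in> nbhd_at G x v"
    by (auto simp: shadow_def Let_def layer_nbhd_def)
  then show ?R
  proof cases
    case 1
    then show ?thesis using G.in_arcsD1 by blast
  next
    case 2
    then show ?thesis
      using G.nbhd_at_sym[of v u x] subsetD[OF nbhd_at_subset, of u G x v] by simp
  qed
next
  assume ?R
  then consider "i = j" "i \<in> {1..card (pverts H)}" "(u, v) \<in> parcs G"
    | "i \<in> {1..card (pverts H)}" "j \<in> layer_nbhd i" "u \<in> pverts G" "v \<in> nbhd_at G x u"
    by blast
  then show ?L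
  proof cases
    case 1
    then show ?thesis by (simp add: shadow_def Let_def)
  next
    case 2
    then have "v \<in> pverts G" "u \<in> nbhd_at G x v"
      using G.nbhd_at_sym[of u v x] subsetD[OF nbhd_at_subset, of v G x u] by simp_all
    moreover have "i \<noteq> j" using 2 layer_nbhd_irrefl by blast
    ultimately show ?thesis using 2 by (simp add: shadow_def Let_def layer_nbhd_def)
  qed
qed

lemma layer_nbhd_sym:
  assumes "i \<in> {1..card (pverts H)}" "j \<in> layer_nbhd i"
  shows "i \<in> layer_nbhd j"
  using assms by (auto simp: layer_nbhd_def intro: H.arcs_symmetric)

text \<open>An arc inside a layer is no loop because \<open>G\<close> has none; every other arc
  changes the layer because \<open>H\<close> has no loops.\<close>

lemma pair_graph_shadow: "pair_graph (shadow G H w x)"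
proof -
  let ?S = "shadow G H w x"
  have fin: "finite (pverts ?S)"
    using G.pair_finite_verts by (simp add: pverts_shadow)
  have wf: "e \<in> pverts ?S \<times> pverts ?S" and loop: "fst e \<noteq> snd e" if "e \<in> parcs ?S" for e
  proof -
    obtain u i v j where e: "e = ((u, i), (v, j))" by (metis prod.collapse)
    show "e \<in> pverts ?S \<times> pverts ?S"
      using that G.in_arcsD2 nbhd_at_subset
      by (fastforce simp: e arc_shadow_iff pverts_shadow layer_nbhd_def)
    show "fst e \<noteq> snd e"
      using that G.no_loops' layer_nbhd_irrefl by (auto simp: e arc_shadow_iff)
  qed
  have "((v, j), (u, i)) \<in> parcs ?S" if "((u, i), (v, j)) \<in> parcs ?S" for u i v j
    using that wf[OF that] layer_nbhd_sym[of i j] G.arcs_symmetric[of u v] G.nbhd_at_sym[of u v x]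
    by (auto simp: arc_shadow_iff pverts_shadow)
  then have sym: "sym (parcs ?S)"
    by (auto intro: symI)
  have "finite (parcs ?S)"
    by (rule finite_subset[of _ "pverts ?S \<times> pverts ?S"]) (use wf fin in blast)+
  then show ?thesis
    using wf loop fin sym by unfold_locales (auto simp: symmetric_def)
qed

section \<open>Degrees and numbers of common neighbors in the shadow\<close>

lemma nbhd_shadow:
  assumes "u \<in> pverts G" "i \<in> {1..card (pverts H)}"
  shows "nbhd (shadow G H w x) (u, i) = nbhd G u \<times> {i} \<union> nbhd_at G x u \<times> layer_nbhd i"
proof -
  interpret S: pair_graph "shadow G H w x" by (rule pair_graph_shadow)
  show ?thesis
    using assms by (auto simp: S.in_nbhd_iff G.in_nbhd_iff arc_shadow_iff)
qed

lemma card_nbhd_shadow: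
  assumes "u \<in> pverts G" "i \<in> {1..card (pverts H)}"
  shows "card (nbhd (shadow G H w x) (u, i)) =
    card (nbhd G u) + card (nbhd_at G x u) * card (nbhd H (w i))"
proof -
  have "card (nbhd G u \<times> {i} \<union> nbhd_at G x u \<times> layer_nbhd i) =
      card (nbhd G u \<times> {i}) + card (nbhd_at G x u \<times> layer_nbhd i)"
    by (rule card_Un_disjoint)
       (use layer_nbhd_irrefl in \<open>auto simp: finite_nbhd finite_nbhd_at finite_layer_nbhd\<close>)
  then show ?thesis
    by (simp add: nbhd_shadow[OF assms] card_cartesian_product card_layer_nbhd)
qed

text \<open>The mixed intersections vanish: arcs of \<open>G\<close> stay in layer \<open>i\<close>,
  while all other arcs leave it.\<close>

lemma card_common_nbhd_same_layer:
  assumes "u \<in> pverts G" "v \<in> pverts G" "i \<in> {1..card (pverts H)}"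
  shows "card (nbhd (shadow G H w x) (u, i) \<inter> nbhd (shadow G H w x) (v, i)) =
    card (nbhd G u \<inter> nbhd G v) +
    card (nbhd_at G x u \<inter> nbhd_at G x v) * card (nbhd H (w i))"
proof -
  let ?A = "(nbhd G u \<inter> nbhd G v) \<times> {i}"
  let ?B = "(nbhd_at G x u \<inter> nbhd_at G x v) \<times> layer_nbhd i"
  have "nbhd (shadow G H w x) (u, i) \<inter> nbhd (shadow G H w x) (v, i) = ?A \<union> ?B"
    using layer_nbhd_irrefl[of i] assms by (auto simp: nbhd_shadow)
  moreover have "card (?A \<union> ?B) = card ?A + card ?B"
    by (rule card_Un_disjoint)
       (use layer_nbhd_irrefl in \<open>auto simp: finite_nbhd finite_nbhd_at finite_layer_nbhd\<close>)
  ultimately show ?thesis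
    by (simp add: card_cartesian_product card_layer_nbhd)
qed

text \<open>A common neighbor lies in layer \<open>j\<close>, in layer \<open>i\<close>, or in a
  third layer adjacent to both, which gives the three summands. In layer \<open>j\<close> it is a
  \<open>G\<close>-neighbor of \<open>v\<close> and at distance \<open>x\<close> from
  \<open>u\<close>; in layer \<open>i\<close> the roles are exchanged.\<close>

lemma card_common_nbhd_adjacent_layers:
  assumes "u \<in> pverts G" "v \<in> pverts G" "i \<in> {1..card (pverts H)}" "j \<in> layer_nbhd i"
  shows "card (nbhd (shadow G H w x) (u, i) \<inter> nbhd (shadow G H w x) (v, j)) =
    card (nbhd_at G x u \<inter> nbhd G v) + card (nbhd G u \<inter> nbhd_at G x v) +
    card (nbhd_at G x u \<inter> nbhd_at G x v) * card (nbhd H (w i) \<inter> nbhd H (w j))"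
proof -
  let ?A = "(nbhd_at G x u \<inter> nbhd G v) \<times> {j}"
  let ?B = "(nbhd G u \<inter> nbhd_at G x v) \<times> {i}"
  let ?C = "(nbhd_at G x u \<inter> nbhd_at G x v) \<times> (layer_nbhd i \<inter> layer_nbhd j)"
  have j: "j \<in> {1..card (pverts H)}" and ij: "i \<in> layer_nbhd j" "i \<noteq> j"
    using assms layer_nbhd_irrefl layer_nbhd_sym by (auto simp: layer_nbhd_def)
  have "nbhd (shadow G H w x) (u, i) \<inter> nbhd (shadow G H w x) (v, j) = ?A \<union> ?B \<union> ?C"
    using ij assms(4) layer_nbhd_irrefl[of i] layer_nbhd_irrefl[of j]
    by (auto simp: nbhd_shadow[OF assms(1,3)] nbhd_shadow[OF assms(2) j])
  moreover have "card (?A \<union> ?B \<union> ?C) = card (?A \<union> ?B) + card ?C"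
    by (rule card_Un_disjoint)
       (use layer_nbhd_irrefl in \<open>auto simp: finite_nbhd finite_nbhd_at finite_layer_nbhd\<close>)
  moreover have "card (?A \<union> ?B) = card ?A + card ?B"
    by (rule card_Un_disjoint) (use ij in \<open>auto simp: finite_nbhd finite_nbhd_at\<close>)
  ultimately show ?thesis
    by (simp add: card_cartesian_product card_layer_nbhd_Int)
qed

end

section \<open>Edge-regularity of the shadow of \<open>G\<close> with respect to itself\<close>

theorem theorem4p2:
  fixes G :: "'a pair_pre_digraph" and n d l x :: nat and w :: "nat \<Rightarrow> 'a"
  assumes "G \<in> ER n d l"
    and "x \<ge> 1"
    and "bij_betw w {1..n} (pverts G)"
  shows "edge_regular (shadow G G w x) \<longleftrightarrow>
    (\<exists>dbar lbar :: int.
      (\<forall>v \<in> pverts G. int d * (1 + int (card (nbhd_at G x v))) = dbar) \<and>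
      (\<forall>u \<in> pverts G. \<forall>v \<in> pverts G. (u, v) \<in> parcs G \<longrightarrow>
         int l + int d * int (card (nbhd_at G x u \<inter> nbhd_at G x v)) = lbar) \<and>
      (\<forall>v \<in> pverts G. \<forall>w' \<in> pverts G. w' \<in> nbhd_at G x v \<longrightarrow>
         int (card (nbhd_at G x v \<inter> nbhd G w')) + int (card (nbhd G v \<inter> nbhd_at G x w'))
           + int l * int (card (nbhd_at G x v \<inter> nbhd_at G x w')) = lbar))"
proof -
  have n: "card (pverts G) = n" and pg: "pair_graph G"
    and deg: "\<And>v. v \<in> pverts G \<Longrightarrow> card (nbhd G v) = d"
    and com: "\<And>u v. (u, v) \<in> parcs G \<Longrightarrow> card (nbhd G u \<inter> nbhd G v) = l"
    using assms(1) by (auto simp: ER_def)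
  interpret G: pair_graph G by (rule pg)
  interpret graph_shadow G G w x
    by unfold_locales (use assms(3) n in simp)
  let ?S = "shadow G G w x"
  interpret S: pair_graph ?S by (rule pair_graph_shadow)
  \<comment> \<open>With \<open>H = G\<close> the layer factors become parameters of
    \<open>G\<close>: a layer has \<open>d\<close> adjacent layers, and two adjacent layers have
    \<open>l\<close> common ones.\<close>
  have S_deg: "card (nbhd ?S (u, i)) = d * (1 + card (nbhd_at G x u))"
    if "u \<in> pverts G" "i \<in> {1..n}" for u i
    using that card_nbhd_shadow[of u i] layer_in_verts[of i] by (simp add: deg n)
  have S_same: "card (nbhd ?S (u, i) \<inter> nbhd ?S (v, i)) =
      l + d * card (nbhd_at G x u \<inter> nbhd_at G x v)"
    if "(u, v) \<in> parcs G" "i \<in> {1..n}" for u v i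
    using that card_common_nbhd_same_layer[of u v i] layer_in_verts[of i] G.wellformed'[of u v]
    by (simp add: deg com n)
  have S_adj: "card (nbhd ?S (u, i) \<inter> nbhd ?S (v, j)) =
      card (nbhd_at G x u \<inter> nbhd G v) + card (nbhd G u \<inter> nbhd_at G x v) +
      l * card (nbhd_at G x u \<inter> nbhd_at G x v)"
    if "u \<in> pverts G" "v \<in> pverts G" "i \<in> {1..n}" "j \<in> layer_nbhd i" for u v i j
    using that card_common_nbhd_adjacent_layers[of u v i j] com[of "w i" "w j"]
    by (simp add: n layer_nbhd_def)
  have layer: "\<exists>i\<in>{1..n}. w i = u" if "u \<in> pverts G" for u
    using that bij_betw_imp_surj_on[OF assms(3)] by (metis imageE)
  show ?thesis (is "?L \<longleftrightarrow> (\<exists>dbar lbar. ?P dbar lbar)")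
  proof
    assume ?L
    then obtain d' l' where
      d': "\<And>p. p \<in> pverts ?S \<Longrightarrow> card (nbhd ?S p) = d'" and
      l': "\<And>p q. (p, q) \<in> parcs ?S \<Longrightarrow> card (nbhd ?S p \<inter> nbhd ?S q) = l'"
      unfolding edge_regular_def ER_def by blast
    have "d * (1 + card (nbhd_at G x v)) = d'" if v: "v \<in> pverts G" for v
    proof -
      \<comment> \<open>Any layer would do; the vertex \<open>v\<close> only guarantees that one
        exists.\<close>
      obtain i where "i \<in> {1..n}" using layer[OF v] by blast
      then show ?thesis
        using v S_deg[of v i] d'[of "(v, i)"] by (simp add: pverts_shadow n)
    qed
    moreover have "l + d * card (nbhd_at G x u \<inter> nbhd_at G x v) = l'"
      if uv: "(u, v) \<in> parcs G" for u v
    proof -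
      obtain i where "i \<in> {1..n}" using layer[OF G.in_arcsD1[OF uv]] by blast
      then show ?thesis
        using uv S_same[of u v i] l'[of "(u, i)" "(v, i)"] G.in_arcsD1[OF uv]
        by (simp add: arc_shadow_iff n)
    qed
    moreover have "card (nbhd_at G x v \<inter> nbhd G w') + card (nbhd G v \<inter> nbhd_at G x w')
        + l * card (nbhd_at G x v \<inter> nbhd_at G x w') = l'"
      if v: "v \<in> pverts G" and w': "w' \<in> nbhd_at G x v" for v w'
    proof -
      obtain v' where vv': "(v, v') \<in> parcs G"
        using G.arc_of_nbhd_at[OF w' assms(2)] .
      \<comment> \<open>Here \<open>v\<close> also serves as the label of a layer, since it is the
        vertex known to have a neighbor.\<close>
      obtain i j where i: "i \<in> {1..n}" "w i = v" and j: "j \<in> {1..n}" "w j = v'"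
        using layer[OF v] layer[OF G.in_arcsD2[OF vv']] by blast
      then have ij: "j \<in> layer_nbhd i" using vv' by (simp add: layer_nbhd_def n)
      have "((v, i), (w', j)) \<in> parcs ?S"
        using v w' i ij by (simp add: arc_shadow_iff n)
      then show ?thesis
        using l' S_adj[OF v _ i(1) ij, of w'] w' nbhd_at_subset[of G x v] by auto
    qed
    \<comment> \<open>The witnesses are the parameters of the shadow, cast from \<open>nat\<close>
      to \<open>int\<close>.\<close>
    ultimately have "?P (int d') (int l')"
      by (auto simp flip: of_nat_mult of_nat_add of_nat_Suc)
    then show "\<exists>dbar lbar. ?P dbar lbar" by blast
  next
    assume "\<exists>dbar lbar. ?P dbar lbar"
    then obtain dbar lbar where P: "?P dbar lbar" by blast
    \<comment> \<open>Nothing says that \<open>dbar\<close> or \<open>lbar\<close> is nonnegative. A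
      vertex, respectively an arc, of the shadow equates it with a cardinality, so
      \<open>nat\<close> loses nothing; without one the claim is vacuous.\<close>
    have "card (nbhd ?S p) = nat dbar" if "p \<in> pverts ?S" for p
    proof -
      obtain u i where p: "p = (u, i)" by (cases p)
      then have u: "u \<in> pverts G" "i \<in> {1..n}" using that by (auto simp: pverts_shadow n)
      then have "int (card (nbhd ?S p)) = dbar"
        using P u(1) by (simp add: p S_deg[OF u] distrib_left)
      then show ?thesis by simp
    qed
    moreover have "card (nbhd ?S p \<inter> nbhd ?S q) = nat lbar" if pq: "(p, q) \<in> parcs ?S" for p q
    proof -
      obtain u i v j where e: "p = (u, i)" "q = (v, j)" by (cases p, cases q)
      have u: "u \<in> pverts G" "i \<in> {1..n}"
        using pq by (auto simp: e arc_shadow_iff n)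
      consider "(u, v) \<in> parcs G" "i = j" | "v \<in> nbhd_at G x u" "j \<in> layer_nbhd i"
        using pq by (auto simp: e arc_shadow_iff)
      then have "int (card (nbhd ?S p \<inter> nbhd ?S q)) = lbar"
      proof cases
        case 1
        then show ?thesis
          using P u S_same[of u v i] G.in_arcsD2[of u v] by (simp add: e)
      next
        case 2
        then have "v \<in> pverts G" using nbhd_at_subset[of G x u] by blast
        then show ?thesis
          using P u 2 S_adj[of u v i j] by (simp add: e)
      qed
      then show ?thesis by simp
    qed
    ultimately have "?S \<in> ER (card (pverts ?S)) (nat dbar) (nat lbar)"
      by (simp add: ER_def pair_graph_shadow)
    then show ?L unfolding edge_regular_def by blast
  qed
qed

end
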